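(* Let $p \ge 2$ and $n \ge 1$ be integers, let $X$ be a uniformly random variable on the set $\{p-1,p-3,p-5,\ldots,1-p\}$, and let $X_1,X_2,\ldots,X_n$ be independent copies of $X$. Then there exist unique real constants $$a_1 > a_2 > \cdots > a_n > 0$$ such that the first $2n$ moments of $$\widetilde{X} = a_1 X_1 + a_2 X_2 + \cdots + a_n X_n$$ agree with the first $2n$ moments of a random variable $Y$ which is uniform on $[-1,1]$. Moreover, these constants satisfy $$\sum_{j=1}^n |a_j-p^{-j}| < \frac{1}{p^n(p-1)}.$$
   Context: The set $\{p-1,p-3,\ldots,1-p\}$ is the $p$-element arithmetic progression $\{p-1-2i : 0\le i\le p-1\}$. The $k$th moment of a random variable $Z$ is $E[Z^k]$; "the first $2n$ moments agree" means $E[\widetilde{X}^k]=E[Y^k]$ for all $1\le k\le 2n$. *)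

theory Defs
  imports "HOL-Probability.Probability"
begin

definition progression :: "nat \<Rightarrow> real set" where
  "progression p = (\<lambda>i. real p - 1 - 2 * real i) ` {0..p - 1}"

definition moment :: "'a measure \<Rightarrow> ('a \<Rightarrow> real) \<Rightarrow> nat \<Rightarrow> real" where
  "moment M Z k = prob_space.expectation M (\<lambda>\<omega>. Z \<omega> ^ k)"

(* The discrete law is pushed forward to the Borel sigma-algebra, so that Z only has to be
   Borel measurable and may take other values on a null set. *)
definition uniform_on_finite :: "'a measure \<Rightarrow> ('a \<Rightarrow> real) \<Rightarrow> real set \<Rightarrow> bool" where
  "uniform_on_finite M Z S \<longleftrightarrow>
     Z \<in> borel_measurable M \<and> distr M borel Z = distr (measure_pmf (pmf_of_set S)) borel (\<lambda>x. x)"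

definition uniform_on_interval :: "'a measure \<Rightarrow> ('a \<Rightarrow> real) \<Rightarrow> real \<Rightarrow> real \<Rightarrow> bool" where
  "uniform_on_interval M Z l u \<longleftrightarrow>
     Z \<in> borel_measurable M \<and> distr M borel Z = uniform_measure lborel {l..u}"

(* Finite sequences a_1, ..., a_n are functions extensional on {1..n}; otherwise the values of a
   outside the index range would destroy uniqueness. *)
definition decreasing_positive :: "nat \<Rightarrow> (nat \<Rightarrow> real) set" where
  "decreasing_positive n =
     {a \<in> extensional {1..n}. (\<forall>i\<in>{1..n}. \<forall>j\<in>{1..n}. i < j \<longrightarrow> a i > a j) \<and> (\<forall>i\<in>{1..n}. a i > 0)}"

end

(*
  Let S(t) = sinh t / t be the moment generating function of Y. That of a * X is S(p a t) / S(a t),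
  so matching moments up to 2n means that the product of S(p a_j t) / S(a_j t) agrees with S(t) up
  to order 2n. Taking logarithmic derivatives, and since t S'(t) / S(t) has nonvanishing even
  coefficients, this becomes the system of power sums (q^k - 1) (b_1^k + ... + b_n^k) = 1 for
  1 <= k <= n, where q = p^2 and b_j = a_j^2. The sequence of all q^(-j) satisfies the same system
  for every k, hence the system says that the product of the 1 - b_j w is the partial sum T of
  degree n of the power series of F(w), the product of all 1 - w / q^j. This gives uniqueness.

  For existence and the estimate, F(q w) = (1 - w) F(w) evaluates F near q^m exactly, and the tail
  F - T is an alternating series. Comparing the two, T changes sign between q^m (1 - c) and
  q^m (1 + c) with c = p^(2m - 2n - 1). So T has n roots, with |a_m - p^(-m)| < p^(m - 2n - 1), and
  these bounds sum to less than 1 / (p^n (p - 1)).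
*)
theory Submission
  imports Defs "HOL-Computational_Algebra.Polynomial_FPS"
begin

unbundle no vec_syntax
unbundle fps_syntax

section \<open>Logarithmic derivatives of formal power series\<close>

lemma fps_prod_nth_0: "(\<Prod>i\<in>I. f i :: 'a :: comm_ring_1 fps) $ 0 = (\<Prod>i\<in>I. f i $ 0)"
  by (induction I rule: infinite_finite_induct) auto

text \<open>The factor \<open>fps_X\<close> makes the substitution of \<open>c * X\<close> multiply
  coefficient \<open>k\<close> simply by \<open>c ^ k\<close>, see
  \<open>fps_logderiv_scale\<close>.\<close>

definition fps_logderiv :: "'a :: field fps \<Rightarrow> 'a fps" where
  "fps_logderiv A = fps_X * fps_deriv A * inverse A"

lemma fps_logderiv_times_self:
  assumes "A $ 0 \<noteq> 0"
  shows "fps_logderiv A * A = fps_X * fps_deriv A"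
  using inverse_mult_eq_1[OF assms] by (simp add: fps_logderiv_def mult.assoc)

lemma fps_logderiv_nth_0 [simp]: "fps_logderiv A $ 0 = 0"
  by (simp add: fps_logderiv_def mult.assoc)

lemma fps_logderiv_1 [simp]: "fps_logderiv 1 = 0"
  by (simp add: fps_logderiv_def)

lemma fps_logderiv_mult:
  assumes "A $ 0 \<noteq> 0" "B $ 0 \<noteq> 0"
  shows "fps_logderiv (A * B) = fps_logderiv A + fps_logderiv B"
proof -
  have "fps_logderiv (A * B) = fps_X * fps_deriv A * inverse A * (inverse B * B)
      + fps_X * fps_deriv B * inverse B * (inverse A * A)"
    by (simp add: fps_logderiv_def fps_inverse_mult algebra_simps)
  also have "\<dots> = fps_logderiv A + fps_logderiv B"
    using assms by (simp add: inverse_mult_eq_1 fps_logderiv_def)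
  finally show ?thesis .
qed

lemma fps_logderiv_prod:
  assumes "\<And>i. i \<in> I \<Longrightarrow> f i $ 0 \<noteq> 0"
  shows "fps_logderiv (\<Prod>i\<in>I. f i) = (\<Sum>i\<in>I. fps_logderiv (f i))"
  using assms
proof (induction I rule: infinite_finite_induct)
  case (insert i I)
  have "(\<Prod>i\<in>I. f i) $ 0 \<noteq> 0"
    using insert by (simp add: fps_prod_nth_0)
  then show ?case
    using insert by (simp add: fps_logderiv_mult)
qed auto

lemma fps_logderiv_scale:
  fixes A :: "'a :: field fps"
  assumes "A $ 0 \<noteq> 0"
  shows "fps_logderiv (A oo (fps_const c * fps_X)) = fps_logderiv A oo (fps_const c * fps_X)"
proof -
  have "fps_deriv (A oo (fps_const c * fps_X)) = (fps_deriv A oo (fps_const c * fps_X)) * fps_const c"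
    by (subst fps_compose_deriv) auto
  moreover have "inverse (A oo (fps_const c * fps_X)) = inverse A oo (fps_const c * fps_X)"
    using assms by (subst fps_inverse_compose) auto
  ultimately show ?thesis
    by (simp add: fps_logderiv_def fps_compose_mult_distrib mult_ac)
qed

text \<open>Comparing coefficients in X A' = L A gives, for k > 0, a recurrence relating A_k and L_k
  to earlier coefficients. Since A_0 = 1 and k is invertible, it can be solved for either of the
  two.\<close>

lemma fps_logderiv_cong_upto:
  fixes A B :: "'a :: field_char_0 fps"
  assumes A: "A $ 0 = 1" and B: "B $ 0 = 1"
  shows "(\<forall>k\<le>n. A $ k = B $ k) \<longleftrightarrow> (\<forall>k\<le>n. fps_logderiv A $ k = fps_logderiv B $ k)"
proof -
  have rec: "of_nat k * C $ k = (\<Sum>i=1..<k. fps_logderiv C $ i * C $ (k - i)) + fps_logderiv C $ k"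
    if C: "C $ 0 = 1" and k: "k > 0" for C :: "'a fps" and k
  proof -
    have "of_nat k * C $ k = (fps_X * fps_deriv C) $ k"
      using k by (cases k) auto
    also have "\<dots> = (fps_logderiv C * C) $ k"
      using C by (simp add: fps_logderiv_times_self)
    also have "\<dots> = (\<Sum>i=0..k. fps_logderiv C $ i * C $ (k - i))"
      by (rule fps_mult_nth)
    also have "{0..k} = insert 0 (insert k {1..<k})"
      using k by auto
    finally show ?thesis
      using C k by simp
  qed
  show ?thesis
  proof (intro iffI allI impI)
    fix k assume eq: "\<forall>k\<le>n. A $ k = B $ k" and "k \<le> n"
    then show "fps_logderiv A $ k = fps_logderiv B $ k"
    proof (induction k rule: less_induct)
      case (less k)
      show ?case
      proof (cases "k = 0")
        case False
        have "(\<Sum>i=1..<k. fps_logderiv A $ i * A $ (k - i)) = (\<Sum>i=1..<k. fps_logderiv B $ i * B $ (k - i))"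
          using less by (intro sum.cong) auto
        then show ?thesis
          using rec[OF A, of k] rec[OF B, of k] False less.prems by auto
      qed auto
    qed
  next
    fix k assume eq: "\<forall>k\<le>n. fps_logderiv A $ k = fps_logderiv B $ k" and "k \<le> n"
    then show "A $ k = B $ k"
    proof (induction k rule: less_induct)
      case (less k)
      show ?case
      proof (cases "k = 0")
        case False
        have "(\<Sum>i=1..<k. fps_logderiv A $ i * A $ (k - i)) = (\<Sum>i=1..<k. fps_logderiv B $ i * B $ (k - i))"
          using less by (intro sum.cong) auto
        then have "of_nat k * A $ k = of_nat k * B $ k"
          using rec[OF A, of k] rec[OF B, of k] False less.prems by auto
        then show ?thesis
          using False by simp
      qed (use A B in auto)
    qed
  qed
qed

lemma fps_logderiv_one_minus_X_nth:
  assumes "k > 0"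
  shows "fps_logderiv (1 - fps_X :: 'a :: field fps) $ k = -1"
proof -
  have "inverse (1 - fps_X :: 'a fps) = Abs_fps (\<lambda>n. 1)"
    by (subst fps_inverse_gp' [symmetric]) simp
  then show ?thesis
    using assms by (simp add: fps_logderiv_def mult.assoc)
qed

text \<open>Summed over the factors of a product, these are minus the power sums of the b_j; with
  \<open>fps_logderiv_cong_upto\<close> this takes the place of Newton's identities.\<close>

lemma fps_logderiv_linear_factor_nth:
  assumes "k > 0"
  shows "fps_logderiv (1 - fps_const b * fps_X :: 'a :: field fps) $ k = - (b ^ k)"
proof -
  have "1 - fps_const b * fps_X = (1 - fps_X) oo (fps_const b * fps_X :: 'a fps)"
    by (simp add: fps_compose_sub_distrib)
  then have "fps_logderiv (1 - fps_const b * fps_X) = fps_logderiv (1 - fps_X) oo (fps_const b * fps_X :: 'a fps)"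
    by (simp only: fps_logderiv_scale) (simp add: fps_logderiv_scale)
  then show ?thesis
    using assms by (simp add: fps_compose_linear fps_logderiv_one_minus_X_nth)
qed

section \<open>The power series of sinh t / t\<close>

definition fps_sinhc :: "'a :: field_char_0 fps" where
  "fps_sinhc = Abs_fps (\<lambda>k. if even k then 1 / fact (Suc k) else 0)"

lemma fps_sinhc_nth_0 [simp]: "fps_sinhc $ 0 = 1"
  by (simp add: fps_sinhc_def)

lemma fps_exp_diff_eq_sinhc:
  "fps_exp c - fps_exp (-c) = fps_const (2 * c) * fps_X * (fps_sinhc oo (fps_const c * fps_X))"
proof (rule fps_ext)
  fix k
  show "(fps_exp c - fps_exp (-c)) $ k = (fps_const (2 * c) * fps_X * (fps_sinhc oo (fps_const c * fps_X))) $ k"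
    by (cases k) (auto simp: mult.assoc fps_compose_linear fps_sinhc_def fact_Suc[symmetric] simp del: fact_Suc)
qed

text \<open>This is sinh'' = sinh rewritten for sinh t = t S(t).\<close>

lemma fps_sinhc_ode:
  "fps_X * fps_deriv (fps_deriv fps_sinhc) + 2 * fps_deriv fps_sinhc = fps_X * (fps_sinhc :: 'a :: field_char_0 fps)"
proof (rule fps_ext)
  fix k
  show "(fps_X * fps_deriv (fps_deriv fps_sinhc) + 2 * fps_deriv fps_sinhc) $ k = (fps_X * (fps_sinhc :: 'a fps)) $ k"
  proof (cases k)
    case 0
    then show ?thesis by (simp add: fps_sinhc_def numeral_fps_const)
  next
    case (Suc j)
    have "(of_nat (Suc (Suc j)) :: 'a) \<noteq> 0" "(of_nat (Suc (Suc (Suc j))) :: 'a) \<noteq> 0"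
      by (simp_all only: of_nat_eq_0_iff)
    then show ?thesis
      using Suc by (auto simp: fps_sinhc_def numeral_fps_const divide_simps fact_reduce)
  qed
qed

text \<open>The logarithmic derivative of sinh t / t is t coth t - 1. The Riccati equation of the
  hyperbolic cotangent gives a recurrence for its coefficients which forces the nonzero ones to
  alternate in sign, so that no information on Bernoulli numbers is needed.\<close>

lemma fps_logderiv_sinhc_riccati:
  defines "L \<equiv> fps_logderiv (fps_sinhc :: 'a :: field_char_0 fps)"
  shows "fps_X * fps_deriv L + L = fps_X ^ 2 - L ^ 2"
proof -
  define S where "S = (fps_sinhc :: 'a fps)"
  define V where "V = inverse S"
  have VS: "V * S = 1"
    unfolding V_def S_def by (rule inverse_mult_eq_1) simp
  have dV: "fps_deriv V = - fps_deriv S * V ^ 2"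
    unfolding V_def by (rule fps_inverse_deriv) (simp add: S_def)
  have ode: "fps_X * fps_deriv (fps_deriv S) + 2 * fps_deriv S = fps_X * S"
    unfolding S_def by (rule fps_sinhc_ode)
  have L: "L = fps_X * fps_deriv S * V"
    by (simp add: L_def fps_logderiv_def S_def V_def)
  have "fps_X * fps_deriv L + L = fps_X * V * (fps_X * fps_deriv (fps_deriv S) + 2 * fps_deriv S) - L ^ 2"
    unfolding L by (simp add: dV algebra_simps power2_eq_square)
  also have "\<dots> = fps_X ^ 2 * (V * S) - L ^ 2"
    unfolding ode by (simp add: algebra_simps power2_eq_square)
  finally show ?thesis
    by (simp add: VS)
qed

lemma fps_logderiv_sinhc_signs:
  defines "L \<equiv> fps_logderiv (fps_sinhc :: real fps)"
  shows "(odd k \<longrightarrow> L $ k = 0) \<and> (even k \<longrightarrow> k > 0 \<longrightarrow> (-1) ^ (k div 2) * L $ k < 0)"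
proof (induction k rule: less_induct)
  case (less k)
  have L0: "L $ 0 = 0"
    by (simp add: L_def)
  \<comment> \<open>Coefficient k of the Riccati equation. The outer terms of the convolution vanish
    because L has no constant term, so only earlier coefficients remain on the right.\<close>
  have rec: "(real k + 1) * L $ k = (if k = 2 then 1 else 0) - (\<Sum>i=1..<k. L $ i * L $ (k - i))"
  proof -
    have "(real k + 1) * L $ k = (fps_X * fps_deriv L + L) $ k"
      by (cases k) (auto simp: algebra_simps)
    also have "\<dots> = (fps_X ^ 2 - L ^ 2) $ k"
      unfolding L_def by (simp only: fps_logderiv_sinhc_riccati)
    also have "\<dots> = (if k = 2 then 1 else 0) - (\<Sum>i=0..k. L $ i * L $ (k - i))"
      by (simp add: power2_eq_square[of L] fps_mult_nth fps_X_power_iff)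
    also have "(\<Sum>i=0..k. L $ i * L $ (k - i)) = (\<Sum>i=1..<k. L $ i * L $ (k - i))"
      by (rule sum.mono_neutral_right) (auto simp: L0 not_less le_less Suc_le_eq)
    finally show ?thesis
      by simp
  qed
  show ?case
  proof (intro conjI impI)
    assume "odd k"
    \<comment> \<open>For odd k one of i and k - i is odd, so the induction hypothesis kills every
      product.\<close>
    have "L $ i * L $ (k - i) = 0" if "i \<in> {1..<k}" for i
      using that less.IH[of i] less.IH[of "k - i"] \<open>odd k\<close> by (cases "even i") auto
    then have "(\<Sum>i=1..<k. L $ i * L $ (k - i)) = 0"
      by (intro sum.neutral) blast
    then have "(real k + 1) * L $ k = 0"
      using rec \<open>odd k\<close> by auto
    then show "L $ k = 0"
      by (simp add: add_eq_0_iff)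
  next
    assume "even k" "k > 0"
    show "(-1) ^ (k div 2) * L $ k < 0"
    proof (cases "k = 2")
      case True
      have "{1..<2::nat} = {1}" by auto
      moreover have "L $ 1 = 0"
        using less.IH[of 1] True by auto
      ultimately show ?thesis
        using rec True by simp
    next
      case False
      \<comment> \<open>The sign is split between the two factors: for even i both become negative,
        so the product is positive, while odd i contribute 0. The term i = 2 makes the sum strictly
        positive.\<close>
      define f where "f i = (-1) ^ (k div 2) * (L $ i * L $ (k - i))" for i
      have f: "f i \<ge> 0 \<and> (even i \<longrightarrow> f i > 0)" if i: "i \<in> {1..<k}" for i
      proof (cases "even i")
        case True
        have "k div 2 = i div 2 + (k - i) div 2"
          using True \<open>even k\<close> i by (auto elim!: evenE simp flip: diff_mult_distrib2)
        then have "f i = ((-1) ^ (i div 2) * L $ i) * ((-1) ^ ((k - i) div 2) * L $ (k - i))"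
          by (simp add: f_def power_add)
        moreover have "\<dots> > 0"
          using less.IH[of i] less.IH[of "k - i"] i True \<open>even k\<close> by (intro mult_neg_neg) auto
        ultimately show ?thesis by simp
      next
        case odd: False
        then show ?thesis
          using less.IH[of i] i by (auto simp: f_def)
      qed
      have "2 \<in> {1..<k}"
        using False \<open>even k\<close> \<open>k > 0\<close> by (auto elim!: evenE)
      then have "(\<Sum>i=1..<k. f i) > 0"
        using f by (intro sum_pos2[of _ 2]) auto
      moreover have "(real k + 1) * ((-1) ^ (k div 2) * L $ k) = - (\<Sum>i=1..<k. f i)"
      proof -
        have "(real k + 1) * ((-1) ^ (k div 2) * L $ k) = (-1) ^ (k div 2) * ((real k + 1) * L $ k)"
          by (simp only: mult_ac)
        also have "\<dots> = - (\<Sum>i=1..<k. f i)"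
          using rec False by (simp add: f_def sum_distrib_left)
        finally show ?thesis .
      qed
      ultimately have "(real k + 1) * ((-1) ^ (k div 2) * L $ k) < 0"
        by simp
      then show ?thesis
        by (simp add: mult_less_0_iff)
    qed
  qed
qed

section \<open>Euler's product and its partial sums\<close>

text \<open>Absolute value of the coefficient of w^k in Euler's product. Comparing coefficients in
  F(q w) = (1 - w) F(w) yields the recurrence \<open>euler_coeff_Suc\<close>.\<close>

definition euler_coeff :: "real \<Rightarrow> nat \<Rightarrow> real" where
  "euler_coeff q k = 1 / (\<Prod>i<k. q ^ Suc i - 1)"

lemma euler_coeff_0 [simp]: "euler_coeff q 0 = 1"
  by (simp add: euler_coeff_def)

lemma euler_coeff_Suc: "euler_coeff q (Suc k) = euler_coeff q k / (q ^ Suc k - 1)"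
  by (simp add: euler_coeff_def)

lemma euler_coeff_pos: "q > 1 \<Longrightarrow> euler_coeff q k > 0"
  unfolding euler_coeff_def by (intro divide_pos_pos prod_pos) (auto intro: one_less_power simp del: power_Suc)

text \<open>This is the power series expansion of Euler's product of all \<open>1 - w / q ^ j\<close> with \<open>j \<ge> 1\<close>;
  only the functional equation \<open>F (q * w) = (1 - w) * F w\<close> of the product is used.\<close>

definition euler_fps :: "real \<Rightarrow> real fps" where
  "euler_fps q = Abs_fps (\<lambda>k. (-1) ^ k * euler_coeff q k)"

text \<open>Logarithmic derivatives turn F(q w) = (1 - w) F(w) into the linear equation q^k L_k = -1
  + L_k for each coefficient.\<close>

lemma fps_logderiv_euler_nth:
  assumes "q > 1" "k > 0"
  shows "fps_logderiv (euler_fps q) $ k = - 1 / (q ^ k - 1)"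
proof -
  have "euler_fps q oo (fps_const q * fps_X) = (1 - fps_X) * euler_fps q"
  proof (rule fps_ext)
    fix j
    show "(euler_fps q oo (fps_const q * fps_X)) $ j = ((1 - fps_X) * euler_fps q) $ j"
    proof (cases j)
      case (Suc i)
      have "q ^ Suc i > 1"
        using assms(1) by (intro one_less_power) auto
      then show ?thesis
        using Suc by (simp add: euler_fps_def fps_compose_linear left_diff_distrib euler_coeff_Suc divide_simps
            del: power_Suc) (simp add: algebra_simps)
    qed (simp add: euler_fps_def left_diff_distrib)
  qed
  then have "fps_logderiv (euler_fps q oo (fps_const q * fps_X)) = fps_logderiv (1 - fps_X) + fps_logderiv (euler_fps q)"
    by (simp add: fps_logderiv_mult euler_fps_def)
  then have "fps_logderiv (euler_fps q) oo (fps_const q * fps_X) = fps_logderiv (1 - fps_X) + fps_logderiv (euler_fps q)"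
    by (simp add: fps_logderiv_scale euler_fps_def)
  then have "(fps_logderiv (euler_fps q) oo (fps_const q * fps_X)) $ k
      = (fps_logderiv (1 - fps_X) + fps_logderiv (euler_fps q)) $ k"
    by simp
  then have "q ^ k * fps_logderiv (euler_fps q) $ k = -1 + fps_logderiv (euler_fps q) $ k"
    using assms(2) by (simp add: fps_compose_linear fps_logderiv_one_minus_X_nth)
  moreover have "q ^ k > 1"
    using assms by (intro one_less_power) auto
  ultimately show ?thesis
    by (simp add: field_simps)
qed

section \<open>Partial sums of Euler's product and the power sum system\<close>

definition euler_section :: "real \<Rightarrow> nat \<Rightarrow> real poly" where
  "euler_section q n = (\<Sum>k\<le>n. monom ((-1) ^ k * euler_coeff q k) k)"

lemma coeff_euler_section: "coeff (euler_section q n) k = (if k \<le> n then (-1) ^ k * euler_coeff q k else 0)"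
  by (auto simp: euler_section_def coeff_sum if_distrib cong: if_cong)

lemma degree_euler_section: "degree (euler_section q n) \<le> n"
  by (rule degree_le) (simp add: coeff_euler_section)

lemma poly_euler_section: "poly (euler_section q n) w = (\<Sum>k\<le>n. (-1) ^ k * euler_coeff q k * w ^ k)"
  by (simp add: euler_section_def poly_sum poly_monom)

text \<open>Both polynomials have degree at most n, so they are equal iff the product agrees with
  Euler's series up to order n. On logarithmic derivatives this compares -(b_1^k + ... + b_n^k) with
  -1 / (q^k - 1).\<close>

lemma power_sums_iff_prod_eq_euler_section:
  assumes "q > 1"
  shows "(\<forall>k\<in>{1..n}. (q ^ k - 1) * (\<Sum>j=1..n. b j ^ k) = 1) \<longleftrightarrow>
         (\<Prod>j=1..n. [:1, - b j:]) = euler_section q n"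
proof -
  define P where "P = (\<Prod>j=1..n. [:1, - b j:])"
  have degP: "degree P \<le> n"
    unfolding P_def by (rule order_trans[OF degree_prod_sum_le]) (auto intro!: order_trans[OF sum_bounded_above[of _ _ 1]])
  have P: "fps_of_poly P = (\<Prod>j=1..n. 1 - fps_const (b j) * fps_X)"
    by (simp add: P_def fps_of_poly_prod fps_of_poly_pCons mult.commute flip: fps_const_neg)
  have "P = euler_section q n \<longleftrightarrow> (\<forall>k\<le>n. fps_of_poly P $ k = euler_fps q $ k)"
  proof
    assume R: "\<forall>k\<le>n. fps_of_poly P $ k = euler_fps q $ k"
    show "P = euler_section q n"
    proof (rule poly_eqI)
      fix k
      show "coeff P k = coeff (euler_section q n) k"
        using R degP by (cases "k \<le> n") (auto simp: coeff_euler_section euler_fps_def coeff_eq_0)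
    qed
  qed (auto simp: coeff_euler_section euler_fps_def)
  also have "\<dots> \<longleftrightarrow> (\<forall>k\<le>n. fps_logderiv (fps_of_poly P) $ k = fps_logderiv (euler_fps q) $ k)"
    by (rule fps_logderiv_cong_upto) (auto simp: P fps_prod_nth_0 euler_fps_def)
  also have "\<dots> \<longleftrightarrow> (\<forall>k\<in>{1..n}. fps_logderiv (fps_of_poly P) $ k = fps_logderiv (euler_fps q) $ k)"
    by (metis atLeastAtMost_iff fps_logderiv_nth_0 less_one not_le)
  also have "\<dots> \<longleftrightarrow> (\<forall>k\<in>{1..n}. (q ^ k - 1) * (\<Sum>j=1..n. b j ^ k) = 1)"
  proof (rule ball_cong[OF refl])
    fix k assume k: "k \<in> {1..n}"
    have "fps_logderiv (fps_of_poly P) $ k = - (\<Sum>j=1..n. b j ^ k)"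
      using k unfolding P by (subst fps_logderiv_prod)
        (auto simp: fps_sum_nth fps_logderiv_linear_factor_nth sum_negf)
    moreover have "q ^ k \<noteq> 1"
      using one_less_power[OF assms, of k] k by (metis atLeastAtMost_iff less_irrefl less_le_trans zero_less_one)
    ultimately show "(fps_logderiv (fps_of_poly P) $ k = fps_logderiv (euler_fps q) $ k) \<longleftrightarrow>
        (q ^ k - 1) * (\<Sum>j=1..n. b j ^ k) = 1"
      using assms k by (auto simp: fps_logderiv_euler_nth eq_divide_eq mult.commute)
  qed
  finally show ?thesis
    by (simp add: P_def)
qed

section \<open>Values of Euler's series: functional equation and alternating tail\<close>

definition euler_sum :: "real \<Rightarrow> real \<Rightarrow> real" where
  "euler_sum q w = (\<Sum>k. (-1) ^ k * euler_coeff q k * w ^ k)"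

lemma summable_euler:
  assumes "q > 1"
  shows "summable (\<lambda>k. euler_coeff q k * w ^ k)"
proof -
  \<comment> \<open>From this N on, the ratio |w| / (q^(k+1) - 1) of consecutive terms is at most
    1/2.\<close>
  obtain N where N: "1 + 2 * \<bar>w\<bar> < q ^ N"
    using real_arch_pow[OF assms] by blast
  show ?thesis
  proof (rule summable_ratio_test[of "1/2" N])
    fix k assume "k \<ge> N"
    have q: "q ^ Suc k > 1"
      using assms by (intro one_less_power) auto
    have "q ^ N \<le> q ^ Suc k"
      using assms \<open>k \<ge> N\<close> by (intro power_increasing) auto
    then have "\<bar>w\<bar> / (q ^ Suc k - 1) \<le> 1 / 2"
      using N q by (simp add: field_simps del: power_Suc)
    then have "\<bar>w\<bar> / (q ^ Suc k - 1) * (euler_coeff q k * \<bar>w\<bar> ^ k) \<le> 1 / 2 * (euler_coeff q k * \<bar>w\<bar> ^ k)"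
      using euler_coeff_pos[OF assms, of k] by (intro mult_right_mono) auto
    then show "norm (euler_coeff q (Suc k) * w ^ Suc k) \<le> 1 / 2 * norm (euler_coeff q k * w ^ k)"
      using q euler_coeff_pos[OF assms, of k]
      by (simp add: euler_coeff_Suc abs_mult power_abs mult_ac del: power_Suc) (simp add: mult_ac)
  qed auto
qed

lemma summable_euler_alternating:
  assumes "q > 1"
  shows "summable (\<lambda>k. (-1) ^ k * euler_coeff q k * w ^ k)"
  using summable_euler[OF assms, of "-w"] by (simp add: power_minus[of w] mult_ac)

lemma euler_sum_scale:
  assumes "q > 1"
  shows "euler_sum q (q * w) = (1 - w) * euler_sum q w"
proof -
  let ?f = "\<lambda>k. (-1) ^ k * euler_coeff q k * w ^ k"
  let ?g = "\<lambda>k. (-1) ^ k * euler_coeff q k * (q * w) ^ k"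
  have f: "summable ?f" and g: "summable ?g"
    using summable_euler_alternating[OF assms] by blast+
  have "?g (Suc k) - ?f (Suc k) = - w * ?f k" for k
  proof -
    have "q ^ Suc k > 1"
      using assms by (intro one_less_power) auto
    then show ?thesis
      by (simp add: euler_coeff_Suc divide_simps del: power_Suc) (simp add: algebra_simps)
  qed
  then have "(\<Sum>k. ?g (Suc k) - ?f (Suc k)) = - w * euler_sum q w"
    unfolding euler_sum_def using suminf_mult[OF f, of "-w"] by simp
  moreover have "(\<Sum>k. ?g (Suc k) - ?f (Suc k)) = (\<Sum>k. ?g (Suc k)) - (\<Sum>k. ?f (Suc k))"
    using f g by (intro suminf_diff[symmetric]) (simp_all only: summable_Suc_iff[of ?f] summable_Suc_iff[of ?g])
  ultimately show ?thesis
    using suminf_split_head[OF f] suminf_split_head[OF g] by (simp add: euler_sum_def algebra_simps)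
qed

text \<open>A value far out, at q^m x, is reduced to the value at x, which is easy to estimate for x
  near 1; the zeros are carried by the finite product.\<close>

lemma euler_sum_scale_power:
  assumes "q > 1"
  shows "euler_sum q (q ^ m * x) = (\<Prod>i<m. 1 - q ^ i * x) * euler_sum q x"
proof (induction m)
  case (Suc m)
  have "euler_sum q (q ^ Suc m * x) = euler_sum q (q * (q ^ m * x))"
    by (simp add: mult_ac)
  then show ?case
    by (simp only: euler_sum_scale[OF assms] Suc prod.lessThan_Suc) (simp add: mult_ac)
qed simp

lemma euler_terms_decreasing:
  assumes "q > 1" "0 \<le> w" "w \<le> q ^ Suc k - 1"
  shows "euler_coeff q (Suc k) * w ^ Suc k \<le> euler_coeff q k * w ^ k"
proof -
  have q: "q ^ Suc k > 1"
    using assms(1) by (intro one_less_power) auto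
  have "w / (q ^ Suc k - 1) * (euler_coeff q k * w ^ k) \<le> 1 * (euler_coeff q k * w ^ k)"
    using assms euler_coeff_pos[OF assms(1), of k] q by (intro mult_right_mono) auto
  then show ?thesis
    by (simp add: euler_coeff_Suc mult_ac)
qed

text \<open>For w up to q^(n+1) - 1 the terms decrease in absolute value from index n on, so by
  Leibniz the tail lies between its partial sums of two terms and of one term. \<open>R\<close> is
  the tail with the sign of its leading term removed.\<close>

lemma euler_tail_bounds:
  assumes "q > 1" "0 \<le> w" "w \<le> q ^ Suc n - 1"
  defines "R \<equiv> (\<Sum>k. (-1) ^ k * (euler_coeff q (n + k) * w ^ (n + k)))"
  shows "euler_sum q w = (\<Sum>k<n. (-1) ^ k * euler_coeff q k * w ^ k) + (-1) ^ n * R"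
    and "euler_coeff q n * w ^ n - euler_coeff q (Suc n) * w ^ Suc n \<le> R"
    and "R \<le> euler_coeff q n * w ^ n"
proof -
  let ?a = "\<lambda>k. euler_coeff q (n + k) * w ^ (n + k)"
  have "(\<lambda>k. euler_coeff q k * w ^ k) \<longlonglongrightarrow> 0"
    using summable_euler[OF assms(1)] by (rule summable_LIMSEQ_zero)
  then have a0: "?a \<longlonglongrightarrow> 0"
    using LIMSEQ_ignore_initial_segment[of "\<lambda>k. euler_coeff q k * w ^ k" 0 n] by (simp add: add.commute)
  have apos: "?a k \<ge> 0" for k
    using assms(2) euler_coeff_pos[OF assms(1), of "n + k"] by simp
  have adec: "?a (Suc k) \<le> ?a k" for k
  proof -
    have "q ^ Suc n \<le> q ^ Suc (n + k)"
      using assms(1) by (intro power_increasing) auto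
    then have "w \<le> q ^ Suc (n + k) - 1"
      using assms(3) by linarith
    then show ?thesis
      using euler_terms_decreasing[OF assms(1,2)] by (simp only: add_Suc_right)
  qed
  note leib = summable_Leibniz'[of ?a, OF a0 apos adec]
  show "euler_coeff q n * w ^ n - euler_coeff q (Suc n) * w ^ Suc n \<le> R"
    using leib(2)[of 1] by (simp add: R_def numeral_2_eq_2)
  show "R \<le> euler_coeff q n * w ^ n"
    using leib(4)[of 0] by (simp add: R_def)
  have f: "summable (\<lambda>k. (-1) ^ k * euler_coeff q k * w ^ k)"
    using summable_euler_alternating[OF assms(1)] by blast
  have "(-1) ^ n * R = (\<Sum>k. (-1) ^ n * ((-1) ^ k * ?a k))"
    unfolding R_def by (rule suminf_mult[symmetric]) (rule leib(1))
  also have "\<dots> = (\<Sum>k. (-1) ^ (k + n) * euler_coeff q (k + n) * w ^ (k + n))"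
    by (simp add: power_add mult_ac add.commute)
  finally show "euler_sum q w = (\<Sum>k<n. (-1) ^ k * euler_coeff q k * w ^ k) + (-1) ^ n * R"
    using suminf_split_initial_segment[OF f, of n] by (simp add: euler_sum_def)
qed

lemma euler_sum_ge:
  assumes "q > 1" "0 \<le> x" "x \<le> q - 1"
  shows "euler_sum q x \<ge> 1 - x / (q - 1)"
  using euler_tail_bounds(1,2)[of q x 0] assms by (simp add: euler_coeff_Suc)

text \<open>The Weierstrass product inequality: multiplying a product in [0, 1] by 1 - u_j lowers it
  by at most u_j.\<close>

lemma prod_one_minus_ge:
  fixes u :: "'i \<Rightarrow> real"
  assumes "\<And>i. i \<in> I \<Longrightarrow> 0 \<le> u i \<and> u i \<le> 1"
  shows "(\<Prod>i\<in>I. 1 - u i) \<ge> 1 - (\<Sum>i\<in>I. u i)"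
  using assms
proof (induction I rule: infinite_finite_induct)
  case (insert j I)
  have "(\<Prod>i\<in>I. 1 - u i) \<le> 1" "0 \<le> (\<Prod>i\<in>I. 1 - u i)"
    using insert.prems by (auto intro!: prod_le_1 prod_nonneg)
  then have "u j * (\<Prod>i\<in>I. 1 - u i) \<le> u j * 1"
    using insert.prems by (intro mult_left_mono) auto
  moreover have "1 - (\<Sum>i\<in>I. u i) \<le> (\<Prod>i\<in>I. 1 - u i)"
    using insert by auto
  ultimately show ?case
    using insert.hyps by (simp add: algebra_simps)
qed auto

text \<open>Factor out q^(i+1) x and apply the Weierstrass inequality to u_i = 1 / (q^(i+1) x); the
  geometric series bounds the sum of the u_i by 1 / (x (q - 1)). The condition q x \<ge> 1 gives u_i
  \<le> 1.\<close>

lemma prod_power_Suc_minus_one_ge: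
  fixes q x :: real
  assumes "q > 1" "x > 0" "q * x \<ge> 1"
  shows "(\<Prod>i<k. q ^ Suc i * x - 1) \<ge> x ^ k * (\<Prod>i<k. q ^ Suc i) * (1 - 1 / (x * (q - 1)))"
proof -
  define u where "u i = 1 / (q ^ Suc i * x)" for i
  have u: "0 \<le> u i \<and> u i \<le> 1" for i
  proof -
    have "q * x * 1 \<le> q * x * q ^ i"
      using assms by (intro mult_left_mono one_le_power) auto
    then have "1 \<le> q * x * q ^ i"
      using assms(3) by linarith
    then have "q ^ Suc i * x \<ge> 1"
      by (simp add: mult_ac)
    then show ?thesis
      by (simp add: u_def del: power_Suc)
  qed
  have "(\<Sum>i<k. (1 / q) ^ i) \<le> (\<Sum>i. (1 / q) ^ i)"
    using assms by (intro sum_le_suminf summable_geometric) auto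
  also have "\<dots> = q / (q - 1)"
    using assms by (subst suminf_geometric) (auto simp: field_simps)
  finally have "1 / (q * x) * (\<Sum>i<k. (1 / q) ^ i) \<le> 1 / (q * x) * (q / (q - 1))"
    using assms by (intro mult_left_mono) auto
  also have "1 / (q * x) * (\<Sum>i<k. (1 / q) ^ i) = (\<Sum>i<k. u i)"
    by (simp add: sum_distrib_left u_def power_one_over mult_ac)
  also have "1 / (q * x) * (q / (q - 1)) = 1 / (x * (q - 1))"
    using assms by (simp add: field_simps)
  finally have "1 - 1 / (x * (q - 1)) \<le> 1 - (\<Sum>i<k. u i)"
    by simp
  also have "\<dots> \<le> (\<Prod>i<k. 1 - u i)"
    using u by (intro prod_one_minus_ge) auto
  finally have "(\<Prod>i<k. q ^ Suc i * x) * (1 - 1 / (x * (q - 1))) \<le> (\<Prod>i<k. q ^ Suc i * x) * (\<Prod>i<k. 1 - u i)"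
    using assms by (intro mult_left_mono prod_nonneg) auto
  also have "\<dots> = (\<Prod>i<k. q ^ Suc i * x * (1 - u i))"
    by (rule prod.distrib[symmetric])
  also have "\<dots> = (\<Prod>i<k. q ^ Suc i * x - 1)"
    using assms by (intro prod.cong) (auto simp: u_def field_simps)
  finally show ?thesis
    by (simp add: prod.distrib mult_ac del: power_Suc)
qed

lemma prod_square_power_Suc: "(\<Prod>i<k. (p ^ 2) ^ Suc i) = (p :: real) ^ (k * (k + 1))"
proof (induction k)
  case (Suc k)
  have "Suc k * (Suc k + 1) = k * (k + 1) + 2 * Suc k"
    by simp
  then show ?case
    using Suc by (simp only: prod.lessThan_Suc power_add power_mult)
qed simp

section \<open>Localization of the roots\<close>

text \<open>What is left of \<open>euler_tail_dominated\<close> once k has cancelled. The three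
  factors bound, in this order, the finite product in x, the denominator of the tail coefficient,
  and Euler's series at x. The point x = 1 + 1/p with s = 0 is excluded; there the inequality fails
  for p = 2.\<close>

lemma dominance_scalar:
  fixes p s :: nat and x :: real
  assumes p: "p \<ge> 2" and x: "x = 1 - 1 / real p ^ (2 * s + 1) \<or> x = 1 + 1 / real p ^ (2 * s + 1) \<and> s \<ge> 1"
  defines "Q \<equiv> real p ^ 2 - 1"
  shows "x ^ (s + 2) < real p ^ (s * (s + 1) + 1) * ((1 - 1 / (x * Q)) * (1 - 1 / Q) * (1 - x / Q))"
    and "1 / 2 \<le> x" and "x \<le> 3 / 2"
proof -
  define c where "c = 1 / real p ^ (2 * s + 1)"
  have pow: "real p ^ k \<ge> 2 ^ k" for k
    using p by (intro power_mono) auto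
  have c0: "c > 0"
    using p by (simp add: c_def)
  have c1: "c \<le> 1 / 2"
  proof -
    have "2 \<le> (2::real) ^ (2 * s + 1)"
      by simp
    with pow[of "2 * s + 1"] have "2 \<le> real p ^ (2 * s + 1)"
      by linarith
    then show ?thesis
      unfolding c_def by (auto simp: field_simps)
  qed
  have c2: "c \<le> 1 / 8" if "s \<ge> 1"
  proof -
    have "8 \<le> (2::real) ^ (2 * s + 1)"
      using power_increasing[of 3 "2 * s + 1" "2::real"] that by simp
    with pow[of "2 * s + 1"] have "8 \<le> real p ^ (2 * s + 1)"
      by linarith
    then show ?thesis
      unfolding c_def by (auto simp: field_simps)
  qed
  have xc: "x = 1 - c \<or> x = 1 + c \<and> s \<ge> 1"
    using x by (simp add: c_def)
  show x_ge: "1 / 2 \<le> x" and "x \<le> 3 / 2"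
    using xc c0 c1 by auto
  have Q: "Q \<ge> 3"
    using pow[of 2] by (simp add: Q_def)
  \<comment> \<open>Each factor increases with Q, the first also increases with x and the last
    decreases with x. Hence a lower bound x0 and an upper bound x1 for x, and a lower bound Q0 for
    Q, give the worst case.\<close>
  have factors: "(1 - 1 / (x0 * Q0)) * (1 - 1 / Q0) * (1 - x1 / Q0)
      \<le> (1 - 1 / (x * Q)) * (1 - 1 / Q) * (1 - x / Q)"
    if "0 < x0" "x0 \<le> x" "x \<le> x1" "0 < Q0" "Q0 \<le> Q" "x0 * Q0 > 1" "Q0 > 1" "x1 < Q0" for x0 x1 Q0
  proof -
    have "1 - 1 / (x0 * Q0) \<le> 1 - 1 / (x * Q)"
      using that by (intro diff_left_mono divide_left_mono mult_mono mult_pos_pos) auto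
    moreover have "1 - 1 / Q0 \<le> 1 - 1 / Q"
      using that by (intro diff_left_mono divide_left_mono) auto
    moreover have "1 - x1 / Q0 \<le> 1 - x / Q"
      using that by (intro diff_left_mono frac_le) auto
    moreover have "0 < 1 - 1 / (x0 * Q0)" "0 < 1 - 1 / Q0" "0 < 1 - x1 / Q0"
      using that by simp_all
    ultimately show ?thesis
      by (intro mult_mono mult_nonneg_nonneg) auto
  qed
  let ?K = "(1 - 1 / (x * Q)) * (1 - 1 / Q) * (1 - x / Q)"
  show "x ^ (s + 2) < real p ^ (s * (s + 1) + 1) * ?K"
  proof (cases "s = 0")
    case s: True
    then have xp: "x = 1 - 1 / real p"
      using xc by (simp add: c_def)
    show ?thesis
    \<comment> \<open>For s = 0 and p \<ge> 3 the crude estimates x^2 \<le> 1 and K \<ge> 1/2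
      suffice. For p = 2 the right side is only 10/27, so x = 1/2 is inserted exactly.\<close>
    proof (cases "p = 2")
      case True
      then have x_half: "x = 1 / 2" and Q3: "Q = 3"
        using xp by (simp_all add: Q_def)
      show ?thesis
        unfolding x_half Q3 using s True by (simp add: power2_eq_square)
    next
      case False
      then have p3: "p \<ge> 3"
        using p by simp
      have "3 ^ 2 \<le> real p ^ 2"
        using p3 by (intro power_mono) auto
      then have "8 \<le> Q"
        by (simp add: Q_def)
      moreover have "x \<le> 1"
        using xc s c0 by auto
      ultimately have "(1 - 1 / (1 / 2 * 8)) * (1 - 1 / 8) * (1 - 1 / 8) \<le> ?K"
        using x_ge by (intro factors) auto
      then have "1 / 2 \<le> ?K"
        by (rule order_trans[rotated]) simp
      then have "3 * (1 / 2) \<le> real p * ?K"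
        by (rule mult_mono[rotated]) (use p3 in simp_all)
      moreover have "x ^ 2 \<le> 1"
        using x_ge xc s c0 by (intro power_le_one) auto
      ultimately have "x ^ 2 < real p * ?K"
        by linarith
      then show ?thesis
        by (simp only: s mult_zero_left add_0 power_one_right)
    qed
  next
    case False
    then have s: "s \<ge> 1" by simp
    \<comment> \<open>For s \<ge> 1 the deviation c is at most 1/8, whence K \<ge> 1/4. The power of
      p is at least 2^(s+2), so it is enough that (9/16)^(s+2) \<le> (9/16)^3 < 1/4.\<close>
    have "s + 2 \<le> s * (s + 1) + 1"
      using s by (cases s) auto
    then have "2 ^ (s + 2) \<le> (2::real) ^ (s * (s + 1) + 1)"
      by (intro power_increasing) auto
    with pow[of "s * (s + 1) + 1"] have pp: "2 ^ (s + 2) \<le> real p ^ (s * (s + 1) + 1)"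
      by linarith
    have x_le: "x \<le> 9 / 8" "7 / 8 \<le> x"
      using xc c2[OF s] c0 by auto
    have "(1 - 1 / (7 / 8 * 3)) * (1 - 1 / 3) * (1 - 9 / 8 / 3) \<le> ?K"
      by (rule factors) (use x_le Q in simp_all)
    then have K: "1 / 4 \<le> ?K"
      by (rule order_trans[rotated]) simp
    have "x ^ (s + 2) \<le> (9 / 8) ^ (s + 2)"
      using x_le by (intro power_mono) auto
    also have "\<dots> = (9 / 16) ^ (s + 2) * 2 ^ (s + 2)"
      by (simp flip: power_mult_distrib)
    also have "\<dots> \<le> (9 / 16) ^ 3 * 2 ^ (s + 2)"
      using s by (intro mult_right_mono power_decreasing) auto
    also have "\<dots> < 1 / 4 * 2 ^ (s + 2)"
      by (intro mult_strict_right_mono) (auto simp: power3_eq_cube)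
    also have "\<dots> \<le> ?K * real p ^ (s * (s + 1) + 1)"
      by (rule mult_mono[OF K pp order_trans[OF _ K]]) simp_all
    finally show ?thesis
      by (simp only: mult.commute)
  qed
qed

text \<open>On the left is the leading tail term for the partial sum of degree k + s + 1, on the
  right c times a lower bound for Euler's product without its sign-changing factor. Bounding both
  finite products by powers of p reduces the claim to \<open>dominance_scalar\<close>.\<close>

lemma euler_tail_dominated:
  fixes p k s :: nat and x :: real
  assumes p: "p \<ge> 2" and x: "x = 1 - 1 / real p ^ (2 * s + 1) \<or> x = 1 + 1 / real p ^ (2 * s + 1) \<and> s \<ge> 1"
  defines "q \<equiv> real p ^ 2"
  shows "euler_coeff q (k + s + 2) * (q ^ Suc k * x) ^ (k + s + 2)
     < 1 / real p ^ (2 * s + 1) * ((\<Prod>i<k. q ^ Suc i * x - 1) * (1 - x / (q - 1)))"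
proof -
  define P where "P = real p"
  define A where "A = 1 - 1 / (x * (q - 1))"
  define B where "B = 1 - 1 / (q - 1)"
  define D where "D = 1 - x / (q - 1)"
  define N where "N = k + s + 2"
  have P: "P \<ge> 2"
    using p by (simp add: P_def)
  have q_eq: "q = P ^ 2"
    by (simp add: q_def P_def)
  have x_bounds: "1 / 2 \<le> x" "x \<le> 3 / 2" and scalar: "x ^ (s + 2) < P ^ (s * (s + 1) + 1) * (A * B * D)"
    using dominance_scalar[OF p x] by (simp_all add: A_def B_def D_def q_def P_def)
  have q: "q \<ge> 4"
    using power_mono[of 2 P 2] P by (simp add: q_eq)
  have "1 * 4 \<le> 2 * (x * q)"
    using x_bounds q mult_mono[of 1 "2 * x" 4 q] by simp
  then have xq: "q * x \<ge> 2"
    by (simp add: mult.commute)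
  have B: "B > 0" and D: "D > 0"
    using q x_bounds by (simp_all add: B_def D_def)
  have lower1: "(\<Prod>i<k. q ^ Suc i * x - 1) \<ge> x ^ k * P ^ (k * (k + 1)) * A"
    using prod_power_Suc_minus_one_ge[of q x k] q xq x_bounds
    by (simp add: A_def q_eq prod_square_power_Suc del: power_Suc)
  have lower2: "(\<Prod>i<N. q ^ Suc i - 1) \<ge> P ^ (N * (N + 1)) * B"
    using prod_power_Suc_minus_one_ge[of q 1 N] q
    by (simp add: B_def q_eq prod_square_power_Suc del: power_Suc)
  \<comment> \<open>The excess of the left side over 2 (k + 1) N does not depend on k: it supplies
    the power in the scalar inequality and the factor p^(2s+1) = 1/c.\<close>
  have exponents: "k * (k + 1) + N * (N + 1) = 2 * Suc k * N + ((s * (s + 1) + 1) + (2 * s + 1))"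
    by (simp add: N_def algebra_simps)
  have "(q ^ Suc k * x) ^ N * P ^ (2 * s + 1) = P ^ (2 * Suc k * N + (2 * s + 1)) * x ^ k * x ^ (s + 2)"
  proof -
    have "q ^ Suc k = P ^ (2 * Suc k)"
      by (simp only: q_eq power_mult)
    then have "(q ^ Suc k * x) ^ N = P ^ (2 * Suc k * N) * x ^ N"
      by (simp only: power_mult_distrib power_mult)
    moreover have "x ^ N = x ^ k * x ^ (s + 2)"
      by (simp only: N_def power_add mult.assoc)
    ultimately show ?thesis
      by (simp only: power_add mult_ac)
  qed
  also have "\<dots> < P ^ (2 * Suc k * N + (2 * s + 1)) * x ^ k * (P ^ (s * (s + 1) + 1) * (A * B * D))"
    using scalar P x_bounds by (intro mult_strict_left_mono mult_pos_pos) auto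
  also have "\<dots> = P ^ (k * (k + 1) + N * (N + 1)) * x ^ k * (A * B * D)"
    unfolding exponents by (simp only: power_add mult_ac)
  also have "\<dots> = (P ^ (N * (N + 1)) * B) * ((x ^ k * P ^ (k * (k + 1)) * A) * D)"
    by (simp only: power_add mult_ac)
  also have "\<dots> \<le> (P ^ (N * (N + 1)) * B) * ((\<Prod>i<k. q ^ Suc i * x - 1) * D)"
    using lower1 B D P by (intro mult_left_mono mult_right_mono) auto
  also have "\<dots> \<le> (\<Prod>i<N. q ^ Suc i - 1) * ((\<Prod>i<k. q ^ Suc i * x - 1) * D)"
  proof (intro mult_right_mono lower2 mult_nonneg_nonneg prod_nonneg ballI)
    fix i
    have "q * x * 1 \<le> q * x * q ^ i"
      using q xq by (intro mult_left_mono one_le_power) auto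
    then show "0 \<le> q ^ Suc i * x - 1"
      using xq by (simp add: mult_ac)
  qed (use D in auto)
  finally have *: "(q ^ Suc k * x) ^ N * P ^ (2 * s + 1)
      < (\<Prod>i<N. q ^ Suc i - 1) * ((\<Prod>i<k. q ^ Suc i * x - 1) * D)" .
  have "(\<Prod>i<N. q ^ Suc i - 1) > 0"
    using B P by (intro less_le_trans[OF _ lower2] mult_pos_pos) auto
  then have "1 / (\<Prod>i<N. q ^ Suc i - 1) * (q ^ Suc k * x) ^ N
      < 1 / P ^ (2 * s + 1) * ((\<Prod>i<k. q ^ Suc i * x - 1) * D)"
    using * P by (simp add: field_simps del: power_Suc)
  then show ?thesis
    by (simp only: euler_coeff_def N_def P_def D_def)
qed

text \<open>With \<open>m = k + 1\<close>, \<open>s = n - m\<close> and \<open>w = q ^ m * x\<close>, the partial sum at \<open>w\<close> is Euler's product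
  minus the tail. For \<open>x\<close> on one side of \<open>1\<close>, determined by the parity of \<open>s\<close>, the two contributions
  have the same sign; on the other side the product dominates the tail.\<close>

lemma euler_section_sign:
  fixes p k s :: nat
  assumes p: "p \<ge> 2"
  defines "q \<equiv> real p ^ 2" and "c \<equiv> 1 / real p ^ (2 * s + 1)"
  shows "(-1) ^ Suc k * poly (euler_section q (k + s + 1)) (q ^ Suc k * (1 + c)) > 0"
    and "(-1) ^ Suc k * poly (euler_section q (k + s + 1)) (q ^ Suc k * (1 - c)) < 0"
proof -
  have q: "q \<ge> 4"
    using power_mono[of 2 "real p" 2] p by (simp add: q_def)
  have c: "0 < c" "c \<le> 1 / 2"
    using p dominance_scalar(2)[OF p, of "1 - c" s] by (simp_all add: c_def)
  \<comment> \<open>At w = q^(k+1) x Euler's product equals (-1)^(k+1) (x - 1) G(x): the factor 1 -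
    q^i x with i = 0 is the one that changes sign at x = 1. The tail R starts at k + s + 2, just
    above the degree of the partial sum.\<close>
  define G where "G x = (\<Prod>i<k. q ^ Suc i * x - 1) * euler_sum q x" for x
  define R where "R x = (\<Sum>j. (-1) ^ j * (euler_coeff q (k + s + 2 + j) * (q ^ Suc k * x) ^ (k + s + 2 + j)))" for x
  have eq: "(-1) ^ Suc k * poly (euler_section q (k + s + 1)) (q ^ Suc k * x) = (x - 1) * G x + (-1) ^ s * R x"
    and R: "0 \<le> R x" "R x \<le> euler_coeff q (k + s + 2) * (q ^ Suc k * x) ^ (k + s + 2)"
    and G: "(\<Prod>i<k. q ^ Suc i * x - 1) * (1 - x / (q - 1)) \<le> G x" "0 < G x"
    if x: "1 / 2 \<le> x" "x \<le> 3 / 2" for x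
  proof -
    define w where "w = q ^ Suc k * x"
    have w0: "0 \<le> w"
      using q x by (simp add: w_def)
    have "w \<le> q ^ Suc k * (q - 1)"
      unfolding w_def using x q by (intro mult_left_mono) auto
    also have "\<dots> \<le> q ^ Suc (Suc k) - 1"
      using one_le_power[of q "Suc k"] q by (simp add: algebra_simps)
    also have "\<dots> \<le> q ^ Suc (k + s + 2) - 1"
      using q by (intro diff_right_mono power_increasing) auto
    finally have w1: "w \<le> q ^ Suc (k + s + 2) - 1" .
    have "q > 1" using q by simp
    note tail = euler_tail_bounds[OF this w0 w1]
    have "euler_coeff q (Suc (k + s + 2)) * w ^ Suc (k + s + 2) \<le> euler_coeff q (k + s + 2) * w ^ (k + s + 2)"
      using w0 w1 q by (intro euler_terms_decreasing) auto
    then show "0 \<le> R x" "R x \<le> euler_coeff q (k + s + 2) * (q ^ Suc k * x) ^ (k + s + 2)"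
      using tail(2,3) by (simp_all only: R_def w_def)
    have pos: "q ^ Suc i * x - 1 > 0" for i
    proof -
      have "4 * (1 / 2) \<le> q * x"
        using q x by (intro mult_mono) auto
      moreover have "q * x * 1 \<le> q * x * q ^ i"
        using q x by (intro mult_left_mono one_le_power) auto
      ultimately show ?thesis
        by (simp add: mult_ac)
    qed
    have E: "1 - x / (q - 1) \<le> euler_sum q x"
      using q x by (intro euler_sum_ge) auto
    have D: "0 < 1 - x / (q - 1)"
      using q x by simp
    have prod: "(\<Prod>i<k. q ^ Suc i * x - 1) > 0"
      using pos by (intro prod_pos) auto
    show "(\<Prod>i<k. q ^ Suc i * x - 1) * (1 - x / (q - 1)) \<le> G x"
      unfolding G_def using prod E by (intro mult_left_mono) auto
    show "0 < G x"
      unfolding G_def using prod E D by (intro mult_pos_pos) auto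
    have "(\<Prod>i<Suc k. 1 - q ^ i * x) = (\<Prod>i<Suc k. (-1) * (q ^ i * x - 1))"
      by (intro prod.cong) auto
    also have "\<dots> = (-1) ^ Suc k * (\<Prod>i<Suc k. q ^ i * x - 1)"
      by (simp only: prod.distrib prod_constant card_lessThan)
    also have "(\<Prod>i<Suc k. q ^ i * x - 1) = (x - 1) * (\<Prod>i<k. q ^ Suc i * x - 1)"
      by (simp add: prod.lessThan_Suc_shift del: prod.lessThan_Suc power_Suc)
    finally have F: "euler_sum q w = (-1) ^ Suc k * ((x - 1) * G x)"
      using euler_sum_scale_power[of q "Suc k" x] q by (simp add: w_def G_def mult_ac del: prod.lessThan_Suc power_Suc)
    have "{..k + s + 1} = {..<k + s + 2}"
      by auto
    then have "poly (euler_section q (k + s + 1)) w = euler_sum q w - (-1) ^ (k + s + 2) * R x"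
      using tail(1) by (simp add: poly_euler_section R_def w_def del: power_Suc)
    moreover have "(-1 :: real) ^ (k + s + 2) = (-1) ^ Suc k * (-1) ^ Suc s"
      by (simp add: power_add)
    ultimately have "poly (euler_section q (k + s + 1)) w = (-1) ^ Suc k * ((x - 1) * G x + (-1) ^ s * R x)"
      by (simp add: F algebra_simps)
    moreover have "(-1) ^ Suc k * (-1) ^ Suc k = (1 :: real)"
      by (simp flip: power_mult_distrib)
    ultimately show "(-1) ^ Suc k * poly (euler_section q (k + s + 1)) (q ^ Suc k * x) = (x - 1) * G x + (-1) ^ s * R x"
      by (simp only: w_def mult_1_left flip: mult.assoc)
  qed
  \<comment> \<open>Here |x - 1| = c, so this settles the cases in which the two summands of
    \<open>eq\<close> have opposite signs: 1 - c for even s, and 1 + c for odd s, where s \<ge>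
    1.\<close>
  have dominated: "R x < c * G x" if "x = 1 - c \<or> x = 1 + c \<and> s \<ge> 1" for x
  proof -
    have x: "1 / 2 \<le> x" "x \<le> 3 / 2"
      using that c by auto
    have "R x < c * ((\<Prod>i<k. q ^ Suc i * x - 1) * (1 - x / (q - 1)))"
      using euler_tail_dominated[OF p, of x s k] R(2)[OF x] that unfolding c_def q_def by linarith
    also have "\<dots> \<le> c * G x"
      using G(1)[OF x] c by (intro mult_left_mono) auto
    finally show ?thesis .
  qed
  have x1: "1 / 2 \<le> 1 + c" "1 + c \<le> 3 / 2" and x2: "1 / 2 \<le> 1 - c" "1 - c \<le> 3 / 2"
    using c by auto
  show "(-1) ^ Suc k * poly (euler_section q (k + s + 1)) (q ^ Suc k * (1 + c)) > 0"
  proof (cases "even s")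
    case True
    have "c * G (1 + c) > 0"
      using c G(2)[OF x1] by simp
    then show ?thesis
      using True R(1)[OF x1] by (subst eq[OF x1]) simp
  next
    case False
    then have "s \<ge> 1" by (cases s) auto
    then show ?thesis
      using False dominated[of "1 + c"] by (subst eq[OF x1]) simp
  qed
  show "(-1) ^ Suc k * poly (euler_section q (k + s + 1)) (q ^ Suc k * (1 - c)) < 0"
  proof (cases "even s")
    case True
    then show ?thesis
      using dominated[of "1 - c"] by (subst eq[OF x2]) simp
  next
    case False
    have "c * G (1 - c) > 0"
      using c G(2)[OF x2] by simp
    then show ?thesis
      using False R(1)[OF x2] by (subst eq[OF x2]) simp
  qed
qed

text \<open>Passing from a root to its inverse square root keeps the relative error below c. This
  comes down to (1 - c) (1 + c)^2 \<ge> 1, that is c + c^2 \<le> 1, and (1 + c) (1 - c)^2 \<le>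
  1.\<close>

lemma inverse_sqrt_near_one:
  fixes c y :: real
  assumes "0 < c" "c \<le> 1 / 2" "1 - c < y" "y < 1 + c"
  shows "\<bar>1 / sqrt y - 1\<bar> < c"
proof -
  have y: "y > 0"
    using assms by linarith
  have "1 \<le> (1 - c) * (1 + c) ^ 2"
  proof -
    have "c * (c + c * c) \<le> c * (1 / 2 + 1 / 2 * (1 / 2))"
      using assms by (intro mult_left_mono add_mono mult_mono) auto
    then have "c * (c + c * c) \<le> c" using assms by simp
    then show ?thesis
      by (simp add: algebra_simps power2_eq_square)
  qed
  also have "\<dots> < y * (1 + c) ^ 2"
    using assms by (intro mult_strict_right_mono) auto
  finally have "1 < (sqrt y * (1 + c)) ^ 2"
    using y by (simp add: power_mult_distrib)
  then have "1 < sqrt y * (1 + c)"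
    using power_less_imp_less_base[of 1 2 "sqrt y * (1 + c)"] assms y by simp
  then have "1 / sqrt y < 1 + c"
    using y by (simp add: field_simps)
  moreover have "y * (1 - c) ^ 2 < 1"
  proof -
    have "y * (1 - c) ^ 2 < (1 + c) * (1 - c) ^ 2"
      using assms by (intro mult_strict_right_mono) auto
    also have "\<dots> = (1 - c ^ 2) * (1 - c)"
      by (simp add: algebra_simps power2_eq_square)
    also have "\<dots> \<le> 1 * 1"
      using assms by (intro mult_mono) (auto intro: power_le_one)
    finally show ?thesis by simp
  qed
  then have "(sqrt y * (1 - c)) ^ 2 < 1"
    using y by (simp add: power_mult_distrib)
  then have "sqrt y * (1 - c) < 1"
    using power_less_imp_less_base[of "sqrt y * (1 - c)" 2 1] by simp
  then have "1 - c < 1 / sqrt y"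
    using y by (simp add: field_simps)
  ultimately show ?thesis
    by (simp add: abs_less_iff)
qed

text \<open>The sign changes give one root w_j in each of n disjoint intervals around q^j. Having
  degree at most n and value 1 at 0, the partial sum is then the product of the 1 - w / w_j, and a_j
  = 1 / sqrt w_j.\<close>

lemma euler_section_factorization:
  fixes p n :: nat
  assumes p: "p \<ge> 2"
  obtains a :: "nat \<Rightarrow> real"
  where "\<And>j. j \<in> {1..n} \<Longrightarrow> a j > 0"
    and "\<And>i j. i \<in> {1..n} \<Longrightarrow> j \<in> {1..n} \<Longrightarrow> i < j \<Longrightarrow> a i > a j"
    and "(\<Prod>j=1..n. [:1, - ((a j) ^ 2):]) = euler_section (real p ^ 2) n"
    and "\<And>j. j \<in> {1..n} \<Longrightarrow> \<bar>a j - 1 / real p ^ j\<bar> < 1 / real p ^ (2 * n + 1 - j)"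
proof -
  define q where "q = real p ^ 2"
  define c where "c j = 1 / real p ^ (2 * (n - j) + 1)" for j
  have q: "q \<ge> 4"
    using power_mono[of 2 "real p" 2] p by (simp add: q_def)
  have c: "0 < c j" "c j \<le> 1 / 2" for j
    using p dominance_scalar(2)[OF p, of "1 - c j" "n - j"] by (simp_all add: c_def)
  have "\<exists>w. q ^ j * (1 - c j) < w \<and> w < q ^ j * (1 + c j) \<and> poly (euler_section q n) w = 0" if j: "j \<in> {1..n}" for j
  proof -
    obtain k where k: "j = Suc k"
      using j by (cases j) auto
    have n: "k + (n - Suc k) + 1 = n"
      using j k by auto
    have "0 < (-1) ^ j * poly (euler_section q n) (q ^ j * (1 + c j))"
      and "(-1) ^ j * poly (euler_section q n) (q ^ j * (1 - c j)) < 0"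
      using euler_section_sign[OF p, where k = k and s = "n - j"] by (simp_all only: n q_def c_def k)
    then have "((-1) ^ j * poly (euler_section q n) (q ^ j * (1 - c j))) *
        ((-1) ^ j * poly (euler_section q n) (q ^ j * (1 + c j))) < 0"
      by (rule mult_neg_pos[rotated])
    then have "((-1) ^ j * (-1) ^ j) * (poly (euler_section q n) (q ^ j * (1 - c j)) *
        poly (euler_section q n) (q ^ j * (1 + c j))) < 0"
      by (simp only: mult_ac)
    then have "poly (euler_section q n) (q ^ j * (1 - c j)) * poly (euler_section q n) (q ^ j * (1 + c j)) < 0"
      by (simp flip: power_mult_distrib)
    moreover have "q ^ j * (1 - c j) < q ^ j * (1 + c j)"
      using q c(1)[of j] by (intro mult_strict_left_mono) auto
    ultimately show ?thesis
      using poly_IVT by blast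
  qed
  then obtain w where w: "\<And>j. j \<in> {1..n} \<Longrightarrow> q ^ j * (1 - c j) < w j"
    "\<And>j. j \<in> {1..n} \<Longrightarrow> w j < q ^ j * (1 + c j)"
    "\<And>j. j \<in> {1..n} \<Longrightarrow> poly (euler_section q n) (w j) = 0"
    by metis
  have w_pos: "w j > 0" if "j \<in> {1..n}" for j
  proof -
    have "0 \<le> q ^ j * (1 - c j)"
      using q c(2)[of j] by (intro mult_nonneg_nonneg) auto
    then show ?thesis
      using w(1)[OF that] by linarith
  qed
  \<comment> \<open>The intervals are disjoint: q^i (1 + c_i) \<le> 2 q^i \<le> q^(i+1) / 2 \<le>
    q^j (1 - c_j), using q \<ge> 4.\<close>
  have w_less: "w i < w j" if "i \<in> {1..n}" "j \<in> {1..n}" "i < j" for i j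
  proof -
    have "w i < q ^ i * (1 + c i)"
      using w that by blast
    also have "\<dots> \<le> q ^ i * (4 * (1 / 2))"
      using q c(2)[of i] by (intro mult_left_mono) auto
    also have "\<dots> \<le> q ^ i * (q * (1 / 2))"
      using q by (intro mult_left_mono) auto
    also have "\<dots> = q ^ Suc i * (1 / 2)"
      by simp
    also have "\<dots> \<le> q ^ j * (1 - c j)"
      using q c(2)[of j] that by (intro mult_mono power_increasing) auto
    also have "\<dots> < w j"
      using w that by blast
    finally show ?thesis .
  qed
  define a where "a j = 1 / sqrt (w j)" for j
  have a2: "(a j) ^ 2 = 1 / w j" if "j \<in> {1..n}" for j
    using w_pos[OF that] by (simp add: a_def power_one_over)
  have inj: "inj_on w {1..n}"
    by (rule inj_onI) (metis w_less less_irrefl linorder_neqE_nat)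
  have "0 \<notin> w ` {1..n}"
    using w_pos by force
  \<comment> \<open>The point 0, where both polynomials are 1, completes the n roots to the n + 1
    points that determine a polynomial of degree at most n.\<close>
  then have card: "card (insert 0 (w ` {1..n})) = Suc n"
    using inj by (simp add: card_image)
  have fact: "(\<Prod>j=1..n. [:1, - ((a j) ^ 2):]) = euler_section q n"
  proof (rule poly_eqI_degree[of "insert 0 (w ` {1..n})"])
    show "degree (\<Prod>j=1..n. [:1, - ((a j) ^ 2):]) < card (insert 0 (w ` {1..n}))"
      unfolding card less_Suc_eq_le
      by (rule order_trans[OF degree_prod_sum_le]) (auto intro!: order_trans[OF sum_bounded_above[of _ _ 1]])
    show "degree (euler_section q n) < card (insert 0 (w ` {1..n}))"
      unfolding card less_Suc_eq_le by (rule degree_euler_section)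
    fix z assume z: "z \<in> insert 0 (w ` {1..n})"
    show "poly (\<Prod>j=1..n. [:1, - ((a j) ^ 2):]) z = poly (euler_section q n) z"
    proof (cases "z = 0")
      case True
      then show ?thesis
        using poly_0_coeff_0[of "euler_section q n"] by (simp add: poly_prod coeff_euler_section)
    next
      case False
      then obtain j where j: "j \<in> {1..n}" "z = w j"
        using z by auto
      have "\<exists>i\<in>{1..n}. 1 - z * (a i) ^ 2 = 0"
        using j a2[of j] w_pos[of j] by (intro bexI[of _ j]) auto
      then have "(\<Prod>i=1..n. 1 - z * (a i) ^ 2) = 0"
        by (subst prod_zero_iff) auto
      then show ?thesis
        using w(3) j by (simp add: poly_prod)
    qed
  qed
  show ?thesis
  proof (rule that)
    show "a j > 0" if "j \<in> {1..n}" for j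
      using w_pos[OF that] by (simp add: a_def)
    show "a i > a j" if "i \<in> {1..n}" "j \<in> {1..n}" "i < j" for i j
      unfolding a_def using w_less[OF that] w_pos[of i] that by (intro divide_strict_left_mono) auto
    show "(\<Prod>j=1..n. [:1, - ((a j) ^ 2):]) = euler_section (real p ^ 2) n"
      using fact by (simp only: q_def)
    show "\<bar>a j - 1 / real p ^ j\<bar> < 1 / real p ^ (2 * n + 1 - j)" if j: "j \<in> {1..n}" for j
    proof -
      \<comment> \<open>The root relative to q^j, so that a_j p^j = 1 / sqrt y. The relative error
        c_j thus becomes the absolute error p^(-j) c_j.\<close>
      define y where "y = w j / q ^ j"
      have "1 - c j < y" "y < 1 + c j"
        using w(1,2)[OF j] q by (simp_all add: y_def field_simps)
      then have *: "\<bar>1 / sqrt y - 1\<bar> < c j"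
        by (intro inverse_sqrt_near_one c) auto
      have "sqrt (q ^ j) = real p ^ j"
        by (simp add: q_def real_sqrt_power)
      then have "a j = 1 / real p ^ j * (1 / sqrt y)"
        using p by (simp add: a_def y_def real_sqrt_divide)
      then have "\<bar>a j - 1 / real p ^ j\<bar> = \<bar>1 / real p ^ j * (1 / sqrt y - 1)\<bar>"
        by (simp add: right_diff_distrib)
      also have "\<dots> = 1 / real p ^ j * \<bar>1 / sqrt y - 1\<bar>"
        by (simp add: abs_mult)
      also have "\<dots> < 1 / real p ^ j * c j"
        using p * by (intro mult_strict_left_mono) auto
      also have "\<dots> = 1 / real p ^ (j + (2 * (n - j) + 1))"
        by (simp add: c_def power_add)
      also have "j + (2 * (n - j) + 1) = 2 * n + 1 - j"
        using j by auto
      finally show ?thesis .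
    qed
  qed
qed

section \<open>Exponential generating functions of moments\<close>

definition moment_egf :: "'a measure \<Rightarrow> ('a \<Rightarrow> real) \<Rightarrow> real fps" where
  "moment_egf M Z = Abs_fps (\<lambda>k. moment M Z k / fact k)"

lemma moment_egf_scale: "moment_egf M (\<lambda>\<omega>. a * Z \<omega>) = moment_egf M Z oo (fps_const a * fps_X)"
  by (simp add: moment_egf_def fps_compose_linear moment_def power_mult_distrib)

context prob_space
begin

lemma moment_egf_nth_0 [simp]: "moment_egf M Z $ 0 = 1"
  by (simp add: moment_egf_def moment_def prob_space)

text \<open>The bound is only almost sure, since a law determines its variable only up to null
  sets.\<close>

lemma integrable_power_of_AE_bounded:
  fixes Z :: "'a \<Rightarrow> real"
  assumes "Z \<in> borel_measurable M" "AE \<omega> in M. \<bar>Z \<omega>\<bar> \<le> B"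
  shows "integrable M (\<lambda>\<omega>. Z \<omega> ^ k)"
proof (rule integrable_const_bound)
  show "AE \<omega> in M. norm (Z \<omega> ^ k) \<le> B ^ k"
    using assms(2) by eventually_elim (auto simp: power_abs intro: power_mono)
qed (use assms(1) in measurable)

text \<open>Expand binomially and factor the expectations by independence; the factorials absorb the
  binomial coefficients and leave a Cauchy product.\<close>

lemma moment_egf_add:
  assumes indep: "indep_var borel U borel V"
    and U: "AE \<omega> in M. \<bar>U \<omega>\<bar> \<le> B" and V: "AE \<omega> in M. \<bar>V \<omega>\<bar> \<le> C"
  shows "moment_egf M (\<lambda>\<omega>. U \<omega> + V \<omega>) = moment_egf M U * moment_egf M V"
proof (rule fps_ext)
  fix k
  have intU: "integrable M (\<lambda>\<omega>. U \<omega> ^ i)" and intV: "integrable M (\<lambda>\<omega>. V \<omega> ^ i)" for i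
    using integrable_power_of_AE_bounded U V indep_var_rv1[OF indep] indep_var_rv2[OF indep] by blast+
  have indep_powers: "indep_var borel (\<lambda>\<omega>. U \<omega> ^ i) borel (\<lambda>\<omega>. V \<omega> ^ j)" for i j
    using indep_var_compose[OF indep, of "\<lambda>x. x ^ i" borel "\<lambda>x. x ^ j" borel] by (simp add: comp_def)
  note int = indep_var_integrable[OF indep_powers intU intV]
  have "moment M (\<lambda>\<omega>. U \<omega> + V \<omega>) k = (\<integral>\<omega>. (\<Sum>i\<le>k. of_nat (k choose i) * (U \<omega> ^ i * V \<omega> ^ (k - i))) \<partial>M)"
    by (simp add: moment_def binomial_ring mult.assoc)
  also have "\<dots> = (\<Sum>i\<le>k. of_nat (k choose i) * (\<integral>\<omega>. U \<omega> ^ i * V \<omega> ^ (k - i) \<partial>M))"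
    by (subst Bochner_Integration.integral_sum) (auto intro!: int)
  also have "\<dots> = (\<Sum>i\<le>k. of_nat (k choose i) * (moment M U i * moment M V (k - i)))"
    by (simp add: moment_def indep_var_lebesgue_integral[OF indep_powers intU intV])
  finally have "moment M (\<lambda>\<omega>. U \<omega> + V \<omega>) k / fact k
      = (\<Sum>i\<le>k. of_nat (k choose i) / fact k * (moment M U i * moment M V (k - i)))"
    by (simp add: sum_divide_distrib)
  also have "\<dots> = (\<Sum>i\<le>k. moment M U i / fact i * (moment M V (k - i) / fact (k - i)))"
    by (intro sum.cong refl) (simp add: binomial_fact)
  finally show "moment_egf M (\<lambda>\<omega>. U \<omega> + V \<omega>) $ k = (moment_egf M U * moment_egf M V) $ k"
    by (simp add: moment_egf_def fps_mult_nth atMost_atLeast0)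
qed

lemma moment_egf_sum:
  assumes "finite I" "indep_vars (\<lambda>_. borel) X I"
    and "\<And>i. i \<in> I \<Longrightarrow> AE \<omega> in M. \<bar>X i \<omega>\<bar> \<le> B i"
  shows "moment_egf M (\<lambda>\<omega>. \<Sum>i\<in>I. X i \<omega>) = (\<Prod>i\<in>I. moment_egf M (X i))"
  using assms
proof (induction I rule: finite_induct)
  case empty
  have "moment M (\<lambda>\<omega>. 0) k = (if k = 0 then 1 else 0)" for k
    by (simp add: moment_def power_0_left prob_space)
  then show ?case
    by (intro fps_ext) (simp add: moment_egf_def)
next
  case (insert i I)
  have "\<forall>i\<in>I. AE \<omega> in M. \<bar>X i \<omega>\<bar> \<le> B i"
    using insert.prems by blast
  then have "AE \<omega> in M. \<forall>i\<in>I. \<bar>X i \<omega>\<bar> \<le> B i"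
    using insert.hyps by (simp add: AE_finite_all)
  then have bound: "AE \<omega> in M. \<bar>\<Sum>i\<in>I. X i \<omega>\<bar> \<le> (\<Sum>i\<in>I. B i)"
    by eventually_elim (auto intro!: order_trans[OF sum_abs] sum_mono)
  have "moment_egf M (\<lambda>\<omega>. X i \<omega> + (\<Sum>i\<in>I. X i \<omega>)) = moment_egf M (X i) * moment_egf M (\<lambda>\<omega>. \<Sum>i\<in>I. X i \<omega>)"
    using insert.hyps insert.prems by (intro moment_egf_add[OF indep_vars_sum _ bound]) auto
  also have "moment_egf M (\<lambda>\<omega>. \<Sum>i\<in>I. X i \<omega>) = (\<Prod>i\<in>I. moment_egf M (X i))"
    using insert.prems by (intro insert.IH indep_vars_subset[OF insert.prems(1)]) auto
  finally show ?case
    using insert.hyps by simp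
qed

end

section \<open>Moments of the two uniform laws\<close>

lemma moment_uniform_on_finite:
  assumes "uniform_on_finite M Z S" "finite S" "S \<noteq> {}"
  shows "moment M Z k = (\<Sum>x\<in>S. x ^ k) / card S"
proof -
  have Z: "Z \<in> borel_measurable M" and eq: "distr M borel Z = distr (measure_pmf (pmf_of_set S)) borel (\<lambda>x. x)"
    using assms(1) by (auto simp: uniform_on_finite_def)
  have "moment M Z k = integral\<^sup>L (distr M borel Z) (\<lambda>x. x ^ k)"
    unfolding moment_def using Z by (subst integral_distr) auto
  also have "\<dots> = integral\<^sup>L (measure_pmf (pmf_of_set S)) (\<lambda>x. x ^ k)"
    unfolding eq by (subst integral_distr) auto
  also have "\<dots> = (\<Sum>x\<in>S. x ^ k) / card S"
    using assms by (simp add: integral_pmf_of_set)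
  finally show ?thesis .
qed

lemma AE_uniform_on_finite_bounded:
  assumes "uniform_on_finite M Z S" "finite S" "S \<noteq> {}"
  shows "AE \<omega> in M. \<bar>Z \<omega>\<bar> \<le> Max (abs ` S)"
proof -
  have Z: "Z \<in> borel_measurable M" and eq: "distr M borel Z = distr (measure_pmf (pmf_of_set S)) borel (\<lambda>x. x)"
    using assms(1) by (auto simp: uniform_on_finite_def)
  have "AE x in measure_pmf (pmf_of_set S). \<bar>x\<bar> \<le> Max (abs ` S)"
    using assms by (intro AE_pmfI) auto
  then have "AE x in distr M borel Z. \<bar>x\<bar> \<le> Max (abs ` S)"
    unfolding eq by (subst AE_distr_iff) auto
  then show ?thesis
    using Z by (subst (asm) AE_distr_iff) auto
qed

lemma finite_progression: "finite (progression p)" and progression_nonempty: "progression p \<noteq> {}"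
  by (auto simp: progression_def)

text \<open>The sum of the exponentials e^((p-1-2i)t) telescopes when multiplied by e^t - e^(-t),
  giving e^(pt) - e^(-pt). Both differences are multiples of S, and the common factor 2 p t
  cancels.\<close>

lemma moment_egf_uniform_on_progression:
  assumes "uniform_on_finite M Z (progression p)" "p > 0"
  shows "moment_egf M Z * fps_sinhc = fps_sinhc oo (fps_const (real p) * fps_X)"
proof -
  have range: "{0..p - 1} = {..<p}"
    using assms(2) by auto
  have inj: "inj_on (\<lambda>i. real p - 1 - 2 * real i) {..<p}"
    by (auto simp: inj_on_def)
  then have card: "card (progression p) = p"
    unfolding progression_def range by (simp add: card_image)
  define f where "f i = fps_exp (real p - 2 * real i)" for i
  have egf: "fps_const (real p) * moment_egf M Z = (\<Sum>i<p. fps_exp (real p - 1 - 2 * real i))"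
  proof (rule fps_ext)
    fix k
    have "moment M Z k = (\<Sum>i<p. (real p - 1 - 2 * real i) ^ k) / real p"
      using moment_uniform_on_finite[OF assms(1) finite_progression progression_nonempty, of k]
      unfolding card unfolding progression_def range sum.reindex[OF inj] by simp
    then show "(fps_const (real p) * moment_egf M Z) $ k = (\<Sum>i<p. fps_exp (real p - 1 - 2 * real i)) $ k"
      using assms(2) by (simp add: moment_egf_def fps_sum_nth sum_divide_distrib sum_distrib_left)
  qed
  have "fps_const (real p) * moment_egf M Z * (fps_exp 1 - fps_exp (-1))
      = (\<Sum>i<p. fps_exp (real p - 1 - 2 * real i) * fps_exp 1 - fps_exp (real p - 1 - 2 * real i) * fps_exp (-1))"
    unfolding egf by (simp add: sum_distrib_right right_diff_distrib sum_subtractf)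
  also have "\<dots> = (\<Sum>i<p. f i - f (Suc i))"
    by (simp add: f_def algebra_simps flip: fps_exp_add_mult)
  also have "\<dots> = fps_exp (real p) - fps_exp (- real p)"
    by (subst sum_lessThan_telescope') (simp add: f_def)
  finally have "fps_const (2 * real p) * fps_X * (moment_egf M Z * fps_sinhc)
      = fps_const (2 * real p) * fps_X * (fps_sinhc oo (fps_const (real p) * fps_X))"
    by (simp add: fps_exp_diff_eq_sinhc mult_ac flip: fps_const_mult)
  moreover have "fps_const (2 * real p) * fps_X \<noteq> 0"
    using assms(2) by simp
  ultimately show ?thesis
    by (metis mult_left_cancel)
qed

lemma moment_egf_uniform_on_interval:
  assumes "uniform_on_interval M Z (-1) 1"
  shows "moment_egf M Z = fps_sinhc"
proof (rule fps_ext)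
  fix k
  have Z: "Z \<in> borel_measurable M" and eq: "distr M borel Z = uniform_measure lborel {-1..1}"
    using assms by (auto simp: uniform_on_interval_def)
  have dens: "indicator {-1..1} x / emeasure lborel {-1..1::real} = ennreal (indicator {-1..1} x / 2)" for x :: real
    by (auto simp: indicator_def divide_ennreal[symmetric])
  have "moment M Z k = integral\<^sup>L (uniform_measure lborel {-1..1}) (\<lambda>x. x ^ k)"
    unfolding moment_def eq[symmetric] using Z by (subst integral_distr) auto
  also have "\<dots> = (\<integral>x. indicator {-1..1} x / 2 * x ^ k \<partial>lborel)"
    unfolding uniform_measure_def dens by (subst integral_density) auto
  also have "\<dots> = (\<integral>x. x ^ k * indicator {-1..1} x / 2 \<partial>lborel)"
    by (intro Bochner_Integration.integral_cong) auto
  also have "\<dots> = (1 - (-1) ^ Suc k) / Suc k / 2"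
    using integral_power[of "-1" 1 k] by simp
  also have "\<dots> = (if even k then 1 / Suc k else 0)"
    by (cases "even k") (simp_all del: of_nat_Suc)
  finally show "moment_egf M Z $ k = fps_sinhc $ k"
    by (simp add: moment_egf_def fps_sinhc_def)
qed

section \<open>Matching moments\<close>

text \<open>Coefficient k of the logarithmic derivative for the weighted sum is (p^k - 1) (a_1^k +
  ... + a_n^k) \<mu>_k, to be compared with \<mu>_k. Odd k hold trivially as \<mu>_k = 0; for k = 2i
  > 0 the nonzero \<mu>_k cancels, which leaves the power sum system for p^2 and the a_j^2.\<close>

lemma moments_agree_iff:
  assumes p: "p \<ge> 2" and "prob_space M" "prob_space N"
    and X: "\<And>i. i \<in> {1..n} \<Longrightarrow> uniform_on_finite M (X i) (progression p)"
    and indep: "prob_space.indep_vars M (\<lambda>_. borel) X {1..n}"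
    and Y: "uniform_on_interval N Y (-1) 1"
  shows "(\<forall>k\<in>{1..2 * n}. moment M (\<lambda>\<omega>. \<Sum>j=1..n. a j * X j \<omega>) k = moment N Y k)
     \<longleftrightarrow> (\<Prod>j=1..n. [:1, - ((a j) ^ 2):]) = euler_section (real p ^ 2) n"
proof -
  interpret M: prob_space M by fact
  interpret N: prob_space N by fact
  define \<mu> where "\<mu> = fps_logderiv (fps_sinhc :: real fps)"
  define E where "E = moment_egf M (\<lambda>\<omega>. \<Sum>j=1..n. a j * X j \<omega>)"
  have \<mu>_0: "\<mu> $ 0 = 0"
    by (simp add: \<mu>_def)
  have \<mu>_odd: "\<mu> $ k = 0" if "odd k" for k
    using fps_logderiv_sinhc_signs[of k] that by (simp add: \<mu>_def)
  have \<mu>_even: "\<mu> $ (2 * k) \<noteq> 0" if "k > 0" for k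
    using fps_logderiv_sinhc_signs[of "2 * k"] that by (auto simp: \<mu>_def)
  have E_prod: "E = (\<Prod>j=1..n. moment_egf M (X j) oo (fps_const (a j) * fps_X))"
  proof -
    have "M.indep_vars (\<lambda>_. borel) (\<lambda>j \<omega>. a j * X j \<omega>) {1..n}"
      by (rule M.indep_vars_compose2[OF indep]) auto
    moreover have "AE \<omega> in M. \<bar>a j * X j \<omega>\<bar> \<le> \<bar>a j\<bar> * Max (abs ` progression p)" if "j \<in> {1..n}" for j
      using AE_uniform_on_finite_bounded[OF X[OF that] finite_progression progression_nonempty]
      by eventually_elim (auto simp: abs_mult intro: mult_left_mono)
    ultimately have "E = (\<Prod>j=1..n. moment_egf M (\<lambda>\<omega>. a j * X j \<omega>))"
      unfolding E_def by (intro M.moment_egf_sum) auto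
    then show ?thesis
      by (simp add: moment_egf_scale)
  qed
  have X_logderiv: "fps_logderiv (moment_egf M (X j)) $ k = (real p ^ k - 1) * \<mu> $ k" if "j \<in> {1..n}" for j k
  proof -
    have "fps_logderiv (moment_egf M (X j)) + \<mu> = \<mu> oo (fps_const (real p) * fps_X)"
      using moment_egf_uniform_on_progression[OF X[OF that]] p
      by (simp add: \<mu>_def flip: fps_logderiv_mult fps_logderiv_scale)
    then have "(fps_logderiv (moment_egf M (X j)) + \<mu>) $ k = real p ^ k * \<mu> $ k"
      by (simp add: fps_compose_linear)
    then show ?thesis
      by (simp add: algebra_simps)
  qed
  have E_logderiv: "fps_logderiv E $ k = (real p ^ k - 1) * (\<Sum>j=1..n. a j ^ k) * \<mu> $ k" for k
  proof -
    have "fps_logderiv E $ k = (\<Sum>j=1..n. a j ^ k * ((real p ^ k - 1) * \<mu> $ k))"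
    proof -
      have "fps_logderiv (moment_egf M (X j) oo (fps_const (a j) * fps_X)) $ k = a j ^ k * ((real p ^ k - 1) * \<mu> $ k)"
        if "j \<in> {1..n}" for j
        by (subst fps_logderiv_scale) (simp_all add: fps_compose_linear X_logderiv[OF that])
      then show ?thesis
        unfolding E_prod by (subst fps_logderiv_prod) (simp_all add: fps_sum_nth)
    qed
    then show ?thesis
      by (simp add: sum_distrib_left sum_distrib_right mult_ac)
  qed
  have "(\<forall>k\<in>{1..2 * n}. moment M (\<lambda>\<omega>. \<Sum>j=1..n. a j * X j \<omega>) k = moment N Y k)
      \<longleftrightarrow> (\<forall>k\<in>{1..2 * n}. E $ k = moment_egf N Y $ k)"
    by (simp add: E_def moment_egf_def)
  also have "\<dots> \<longleftrightarrow> (\<forall>k\<le>2 * n. E $ k = fps_sinhc $ k)"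
    unfolding moment_egf_uniform_on_interval[OF Y] E_def
    by (metis M.moment_egf_nth_0 atLeastAtMost_iff fps_sinhc_nth_0 less_one not_le)
  also have "\<dots> \<longleftrightarrow> (\<forall>k\<le>2 * n. fps_logderiv E $ k = \<mu> $ k)"
    unfolding \<mu>_def by (rule fps_logderiv_cong_upto) (simp_all add: E_def)
  also have "\<dots> \<longleftrightarrow> (\<forall>k\<in>{1..n}. ((real p ^ 2) ^ k - 1) * (\<Sum>j=1..n. ((a j) ^ 2) ^ k) = 1)"
  proof (intro iffI ballI allI impI)
    fix k assume *: "\<forall>k\<le>2 * n. fps_logderiv E $ k = \<mu> $ k" and k: "k \<in> {1..n}"
    then have "fps_logderiv E $ (2 * k) = \<mu> $ (2 * k)"
      by auto
    then show "((real p ^ 2) ^ k - 1) * (\<Sum>j=1..n. ((a j) ^ 2) ^ k) = 1"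
      using \<mu>_even[of k] k by (simp add: E_logderiv power_mult)
  next
    fix k assume *: "\<forall>k\<in>{1..n}. ((real p ^ 2) ^ k - 1) * (\<Sum>j=1..n. ((a j) ^ 2) ^ k) = 1" and k: "k \<le> 2 * n"
    consider "k = 0" | "odd k" | i where "k = 2 * i" "i \<in> {1..n}"
    proof (cases "k > 0 \<and> even k")
      case True
      then obtain i where "k = 2 * i"
        by (auto elim: evenE)
      then show ?thesis
        using True k by (intro that(3)) auto
    qed (use that(1,2) in auto)
    then show "fps_logderiv E $ k = \<mu> $ k"
    proof cases
      case (3 i)
      then show ?thesis
        using * by (simp add: E_logderiv power_mult)
    qed (simp_all add: \<mu>_odd \<mu>_0 E_logderiv)
  qed
  also have "\<dots> \<longleftrightarrow> (\<Prod>j=1..n. [:1, - ((a j) ^ 2):]) = euler_section (real p ^ 2) n"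
    using p by (intro power_sums_iff_prod_eq_euler_section) (auto intro: one_less_power)
  finally show ?thesis .
qed

text \<open>The index of a value is recovered from the set of values: exactly i - 1 of them exceed
  the i-th one.\<close>

lemma decreasing_positive_eqI:
  assumes a: "a \<in> decreasing_positive n" and b: "b \<in> decreasing_positive n"
    and eq: "a ` {1..n} = b ` {1..n}"
  shows "a = b"
proof (rule extensionalityI)
  have card: "card {y \<in> c ` {1..n}. y > c i} = i - 1"
    if c: "c \<in> decreasing_positive n" and i: "i \<in> {1..n}" for c i
  proof -
    have less: "c k < c j" if "j \<in> {1..n}" "k \<in> {1..n}" "j < k" for j k
      using c that by (auto simp: decreasing_positive_def)
    have "{y \<in> c ` {1..n}. y > c i} = c ` {1..<i}"
    proof (intro equalityI subsetI)
      fix y assume "y \<in> {y \<in> c ` {1..n}. y > c i}"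
      then obtain j where j: "j \<in> {1..n}" "y = c j" "c j > c i"
        by auto
      then have "j < i"
        using less[OF i j(1)] by (metis less_asym linorder_neqE_nat)
      then show "y \<in> c ` {1..<i}"
        using j by auto
    next
      fix y assume "y \<in> c ` {1..<i}"
      then show "y \<in> {y \<in> c ` {1..n}. y > c i}"
        using less i by force
    qed
    moreover have "inj_on c {1..n}"
      by (rule inj_onI) (metis less less_irrefl linorder_neqE_nat)
    then have "inj_on c {1..<i}"
      by (rule inj_on_subset) (use i in auto)
    ultimately show ?thesis
      by (simp add: card_image)
  qed
  fix i assume i: "i \<in> {1..n}"
  then obtain j where j: "j \<in> {1..n}" "a i = b j"
    using eq by (metis imageE imageI)
  have "i - 1 = j - 1"
    using card[OF a i] card[OF b j(1)] eq j(2) by simp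
  then have "i = j"
    using i j(1) by auto
  then show "a i = b i"
    using j(2) by simp
qed (use a b in \<open>auto simp: decreasing_positive_def\<close>)

theorem theorem1:
  fixes p n :: nat
    and M :: "'a measure" and X :: "nat \<Rightarrow> 'a \<Rightarrow> real"
    and N :: "'b measure" and Y :: "'b \<Rightarrow> real"
  assumes "p \<ge> 2" and "n \<ge> 1"
    and "prob_space M"
    and "\<And>i. i \<in> {1..n} \<Longrightarrow> uniform_on_finite M (X i) (progression p)"
    and "prob_space.indep_vars M (\<lambda>_. borel) X {1..n}"
    and "prob_space N"
    and "uniform_on_interval N Y (-1) 1"
  shows "(\<exists>!a. a \<in> decreasing_positive n \<and>
             (\<forall>k\<in>{1..2 * n}. moment M (\<lambda>\<omega>. \<Sum>j=1..n. a j * X j \<omega>) k = moment N Y k))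
       \<and> (\<forall>a. a \<in> decreasing_positive n \<and>
             (\<forall>k\<in>{1..2 * n}. moment M (\<lambda>\<omega>. \<Sum>j=1..n. a j * X j \<omega>) k = moment N Y k) \<longrightarrow>
             (\<Sum>j=1..n. \<bar>a j - 1 / real p ^ j\<bar>) < 1 / (real p ^ n * (real p - 1)))"
proof -
  let ?P = "\<lambda>a. a \<in> decreasing_positive n \<and>
    (\<forall>k\<in>{1..2 * n}. moment M (\<lambda>\<omega>. \<Sum>j=1..n. a j * X j \<omega>) k = moment N Y k)"
  have P_iff: "?P a \<longleftrightarrow> a \<in> decreasing_positive n \<and>
      (\<Prod>j=1..n. [:1, - ((a j) ^ 2):]) = euler_section (real p ^ 2) n" for a
    using moments_agree_iff[where a = a, OF assms(1,3,6,4,5,7)] by blast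
  obtain b0 where b0: "\<And>j. j \<in> {1..n} \<Longrightarrow> b0 j > 0"
    "\<And>i j. i \<in> {1..n} \<Longrightarrow> j \<in> {1..n} \<Longrightarrow> i < j \<Longrightarrow> b0 i > b0 j"
    "(\<Prod>j=1..n. [:1, - ((b0 j) ^ 2):]) = euler_section (real p ^ 2) n"
    "\<And>j. j \<in> {1..n} \<Longrightarrow> \<bar>b0 j - 1 / real p ^ j\<bar> < 1 / real p ^ (2 * n + 1 - j)"
    using euler_section_factorization[OF assms(1)] by metis
  \<comment> \<open>Restriction makes the witness extensional, as \<open>decreasing_positive\<close>
    demands.\<close>
  define b where "b = restrict b0 {1..n}"
  have b: "?P b"
    unfolding P_iff using b0(1-3) by (simp add: b_def decreasing_positive_def)
  have unique: "a = b" if "?P a" for a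
  proof (rule decreasing_positive_eqI)
    show "a \<in> decreasing_positive n" "b \<in> decreasing_positive n"
      using that b by auto
    \<comment> \<open>The values are read off from the polynomial alone: its roots are the 1 /
      c_j^2, and positivity turns c_j^2 = x^2 into c_j = x.\<close>
    have image: "c ` {1..n} = {x. x > 0 \<and> poly (euler_section (real p ^ 2) n) (1 / x ^ 2) = 0}"
      if c: "?P c" for c
    proof -
      have pos: "c j > 0" if "j \<in> {1..n}" for j
        using c that by (auto simp: decreasing_positive_def)
      have "poly (euler_section (real p ^ 2) n) (1 / x ^ 2) = 0 \<longleftrightarrow> x \<in> c ` {1..n}" if x: "x > 0" for x
      proof -
        have "poly (euler_section (real p ^ 2) n) (1 / x ^ 2) = (\<Prod>j=1..n. 1 - (c j) ^ 2 / x ^ 2)"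
          using c unfolding P_iff by (auto simp: poly_prod simp flip: c[unfolded P_iff, THEN conjunct2])
        also have "\<dots> = 0 \<longleftrightarrow> (\<exists>j\<in>{1..n}. (c j) ^ 2 = x ^ 2)"
        proof -
          have "1 - (c j) ^ 2 / x ^ 2 = 0 \<longleftrightarrow> (c j) ^ 2 = x ^ 2" for j
            using x by auto
          then show ?thesis
            by simp
        qed
        also have "\<dots> \<longleftrightarrow> (\<exists>j\<in>{1..n}. x = c j)"
        proof (intro bex_cong refl)
          fix j assume "j \<in> {1..n}"
          then show "(c j) ^ 2 = x ^ 2 \<longleftrightarrow> x = c j"
            using x pos[of j] by (auto simp: power2_eq_iff)
        qed
        finally show ?thesis by auto
      qed
      then show ?thesis
        using pos by auto
    qed
    show "a ` {1..n} = b ` {1..n}"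
      using image[OF that] image[OF b] by simp
  qed
  have "(\<Sum>j=1..n. \<bar>b j - 1 / real p ^ j\<bar>) < 1 / (real p ^ n * (real p - 1))"
  proof -
    have "(\<Sum>j=1..n. \<bar>b j - 1 / real p ^ j\<bar>) \<le> (\<Sum>j=1..n. 1 / real p ^ (2 * n + 1 - j))"
      using b0(4) by (intro sum_mono) (auto simp: b_def intro: less_imp_le)
    also have "\<dots> = (\<Sum>j=1..n. 1 / real p ^ (n + 1 + (n - j)))"
    proof (intro sum.cong refl)
      fix j assume "j \<in> {1..n}"
      then have "2 * n + 1 - j = n + 1 + (n - j)"
        by auto
      then show "1 / real p ^ (2 * n + 1 - j) = 1 / real p ^ (n + 1 + (n - j))"
        by (simp only:)
    qed
    also have "\<dots> = (\<Sum>i<n. 1 / real p ^ (n + 1 + i))"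
      by (rule sum.reindex_bij_witness[of _ "\<lambda>i. n - i" "\<lambda>j. n - j"]) auto
    also have "\<dots> = 1 / real p ^ (n + 1) * (\<Sum>i<n. (1 / real p) ^ i)"
      by (simp add: sum_distrib_left power_add power_one_over mult.assoc)
    \<comment> \<open>Strictness comes from extending the finite geometric sum to the full
      series.\<close>
    also have "\<dots> < 1 / real p ^ (n + 1) * (\<Sum>i. (1 / real p) ^ i)"
      using assms(1) by (intro mult_strict_left_mono sum_less_suminf summable_geometric) auto
    also have "(\<Sum>i. (1 / real p) ^ i) = real p / (real p - 1)"
      using assms(1) by (subst suminf_geometric) (auto simp: field_simps)
    also have "1 / real p ^ (n + 1) * (real p / (real p - 1)) = 1 / (real p ^ n * (real p - 1))"
      using assms(1) by (simp add: field_simps)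
    finally show ?thesis .
  qed
  then show ?thesis
    using b unique by (intro conjI ex1I[of _ b] allI impI) blast+
qed

end
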